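(* Let $\mathcal{A}=\{A_1,\dots,A_m\}$ be an arbitrary finite family of linear operators on $\mathbb{R}^d$ with probabilities $p_1,\dots,p_m$, sharing a common invariant cone $K$, and let $\lambda$ be its Lyapunov exponent. Then for every functional $f$ on $K$ we have $F_{\max}^{(\infty)}=\lambda$. If, in addition, there is an invariant functional for the family $\mathcal{A}$, then for every functional $f$ on $K$ we have $F_{\min}^{(\infty)}=\lambda$, and in this case $$F_{\max}^{(k)}-F_{\min}^{(k)}\ \le\ C\,k^{-1}\qquad\text{for all } k\in\mathbb{N},$$ where the constant $C$ depends only on $\mathcal{A}$ and on $f$.
   Context: Setting. $p_j>0$, $\sum_{j=1}^m p_j=1$. $K\subset\mathbb{R}^d$ is a convex, closed, solid (nonempty interior), pointed cone with apex at the origin, and $A_jK\subset K$ for all $j$. For $k\in\mathbb{N}$ ($k\ge 1$), $\mathcal{A}^k$ is the family of all $m^k$ products of length $k$ with the product probabilities, and $$\mathbf{E}\{g(B)\mid B\in\mathcal{A}^k\}=\sum_{d_1,\dots,d_k\in\{1,\dots,m\}}p_{d_1}\cdots p_{d_k}\,g(A_{d_k}\cdots A_{d_1}).$$ The Lyapunov exponent is $\lambda=\lim_{k\to\infty}\frac1k\mathbf{E}\{\log\|B\|\mid B\in\mathcal{A}^k\}$ (independent of the norm), with $\log 0=-\infty$. A functional on $K$ is a map $f:K\to\mathbb{R}_+$ that is positive, i.e. $f(x)>0$ whenever $x\ne 0$, and homogeneous, i.e. $f(tx)=tf(x)$ for all $x\in K$, $t\in\mathbb{R}_+$. For such $f$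 set $$F_{\min}^{(k)}=\frac1k\inf_{x\in K,\,f(x)=1}\mathbf{E}\{\log f(Bx)\mid B\in\mathcal{A}^k\},\qquad F_{\max}^{(k)}=\frac1k\sup_{x\in K,\,f(x)=1}\mathbf{E}\{\log f(Bx)\mid B\in\mathcal{A}^k\},$$ and $F_{\min}^{(\infty)}=\lim_{k\to\infty}F_{\min}^{(k)}=\sup_kF_{\min}^{(k)}$, $F_{\max}^{(\infty)}=\lim_{k\to\infty}F_{\max}^{(k)}=\inf_kF_{\max}^{(k)}$. A functional $f$ on $K$ is invariant for $\mathcal{A}$ if $-\log f(x)+\sum_{j=1}^m p_j\log f(A_jx)$ is constant over all $x\in K\setminus\{0\}$.
   Formalization: Both f and the invariant functional are also assumed comparable to the norm on K (a|x| ≤ f(x) ≤ b|x|, a>0; true if continuous), as the claim fails for wild functionals; the bound is stated as F_max ≤ F_min + C/k, since both sides may be −∞. *)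

theory Defs
  imports "HOL-Analysis.Analysis"
begin

definition elog :: "real \<Rightarrow> ereal" where
  "elog x = (if x = 0 then - \<infinity> else ereal (ln x))"

text \<open>A product of length \<open>k\<close> is given by a word \<open>w = [d\<^sub>1, \<dots>, d\<^sub>k]\<close> over \<open>{1..m}\<close>;
  \<open>fold A w\<close> is the composition \<open>A d\<^sub>k \<circ> \<dots> \<circ> A d\<^sub>1\<close>.\<close>

definition expect_prod ::
    "nat \<Rightarrow> (nat \<Rightarrow> real) \<Rightarrow> (nat \<Rightarrow> 'a \<Rightarrow> 'a) \<Rightarrow> nat \<Rightarrow> (('a \<Rightarrow> 'a) \<Rightarrow> ereal) \<Rightarrow> ereal" where
  "expect_prod m p A k g =
     (\<Sum>w\<in>{w. length w = k \<and> set w \<subseteq> {1..m}}. ereal (prod_list (map p w)) * g (fold A w))"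

definition lyapunov_exponent ::
    "nat \<Rightarrow> (nat \<Rightarrow> real) \<Rightarrow> (nat \<Rightarrow> 'a \<Rightarrow> 'a::euclidean_space) \<Rightarrow> ereal" where
  "lyapunov_exponent m p A =
     lim (\<lambda>k. ereal (1 / real k) * expect_prod m p A k (\<lambda>B. elog (onorm B)))"

definition solid_pointed_cone :: "'a::euclidean_space set \<Rightarrow> bool" where
  "solid_pointed_cone K \<longleftrightarrow>
     convex K \<and> closed K \<and> cone K \<and> interior K \<noteq> {} \<and> K \<inter> uminus ` K = {0}"

definition cone_functional :: "'a::real_vector set \<Rightarrow> ('a \<Rightarrow> real) \<Rightarrow> bool" where
  "cone_functional K f \<longleftrightarrow>
     (\<forall>x\<in>K. f x \<ge> 0) \<and> (\<forall>x\<in>K. x \<noteq> 0 \<longrightarrow> f x > 0) \<and>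
     (\<forall>x\<in>K. \<forall>t\<ge>0. f (t *\<^sub>R x) = t * f x)"

text \<open>Positivity and homogeneity alone allow a functional that is arbitrarily wild from ray to ray,
  and for such functionals \<open>F_max\<close> can be infinite for every \<open>k\<close>.  Comparability
  with the norm on the cone excludes this.  Every continuous functional is comparable (see
  \<open>continuous_imp_norm_comparable\<close> below), but continuity is not required.\<close>

definition norm_comparable :: "'a::real_normed_vector set \<Rightarrow> ('a \<Rightarrow> real) \<Rightarrow> bool" where
  "norm_comparable K f \<longleftrightarrow>
     (\<exists>a>0. \<exists>b. \<forall>x\<in>K. a * norm x \<le> f x \<and> f x \<le> b * norm x)"

definition F_min ::
    "nat \<Rightarrow> (nat \<Rightarrow> real) \<Rightarrow> (nat \<Rightarrow> 'a \<Rightarrow> 'a) \<Rightarrow> 'a set \<Rightarrow> ('a \<Rightarrow> real) \<Rightarrow> nat \<Rightarrow> ereal" where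
  "F_min m p A K f k =
     ereal (1 / real k) * (INF x\<in>{x\<in>K. f x = 1}. expect_prod m p A k (\<lambda>B. elog (f (B x))))"

definition F_max ::
    "nat \<Rightarrow> (nat \<Rightarrow> real) \<Rightarrow> (nat \<Rightarrow> 'a \<Rightarrow> 'a) \<Rightarrow> 'a set \<Rightarrow> ('a \<Rightarrow> real) \<Rightarrow> nat \<Rightarrow> ereal" where
  "F_max m p A K f k =
     ereal (1 / real k) * (SUP x\<in>{x\<in>K. f x = 1}. expect_prod m p A k (\<lambda>B. elog (f (B x))))"

definition F_min_lim ::
    "nat \<Rightarrow> (nat \<Rightarrow> real) \<Rightarrow> (nat \<Rightarrow> 'a \<Rightarrow> 'a) \<Rightarrow> 'a set \<Rightarrow> ('a \<Rightarrow> real) \<Rightarrow> ereal" where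
  "F_min_lim m p A K f = lim (F_min m p A K f)"

definition F_max_lim ::
    "nat \<Rightarrow> (nat \<Rightarrow> real) \<Rightarrow> (nat \<Rightarrow> 'a \<Rightarrow> 'a) \<Rightarrow> 'a set \<Rightarrow> ('a \<Rightarrow> real) \<Rightarrow> ereal" where
  "F_max_lim m p A K f = lim (F_max m p A K f)"

text \<open>The constant is an extended real: it may be \<open>- \<infinity>\<close>, in which case \<open>F_min\<close> and \<open>F_max\<close>
  are both \<open>- \<infinity>\<close>.  As \<open>- \<infinity> - (- \<infinity>) = \<infinity>\<close> in \<open>ereal\<close>, a bound \<open>F_max - F_min \<le> c\<close>
  has to be written \<open>F_max \<le> F_min + c\<close>.\<close>

definition invariant_for ::
    "nat \<Rightarrow> (nat \<Rightarrow> real) \<Rightarrow> (nat \<Rightarrow> 'a \<Rightarrow> 'a::real_vector) \<Rightarrow> 'a set \<Rightarrow> ('a \<Rightarrow> real) \<Rightarrow> bool" where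
  "invariant_for m p A K f \<longleftrightarrow>
     (\<lambda>x. - elog (f x) + (\<Sum>j=1..m. ereal (p j) * elog (f (A j x)))) constant_on (K - {0})"

lemma continuous_imp_norm_comparable:
  fixes K :: "'a::euclidean_space set"
  assumes "closed K" and "cone K" and "cone_functional K f" and "continuous_on K f"
  shows "norm_comparable K f"
proof -
  define S where "S = K \<inter> sphere 0 1"
  have S: "compact S" "S \<subseteq> K" "\<And>x. x \<in> S \<Longrightarrow> norm x = 1"
    unfolding S_def using assms(1) by (auto intro: closed_Int_compact)
  have cont: "continuous_on S f"
    using assms(4) S(2) continuous_on_subset by blast
  have pos: "f x > 0" if "x \<in> S" for x
  proof -
    have "x \<noteq> 0" using S(3)[OF that] by auto
    then show ?thesis using assms(3) S(2) that unfolding cone_functional_def by blast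
  qed
  obtain a b where a: "a > 0" and ab: "\<And>x. x \<in> S \<Longrightarrow> a \<le> f x \<and> f x \<le> b"
  proof (cases "S = {}")
    case True
    then show ?thesis using that[of 1 1] by auto
  next
    case False
    obtain u where "u \<in> S" "\<forall>y\<in>S. f u \<le> f y"
      using continuous_attains_inf[OF S(1) False cont] by blast
    moreover obtain v where "v \<in> S" "\<forall>y\<in>S. f y \<le> f v"
      using continuous_attains_sup[OF S(1) False cont] by blast
    ultimately show ?thesis using that[of "f u" "f v"] pos by blast
  qed
  have "a * norm x \<le> f x \<and> f x \<le> b * norm x" if x: "x \<in> K" for x
  proof (cases "x = 0")
    case True
    have "f (0 *\<^sub>R x) = 0 * f x"
      using assms(3) x unfolding cone_functional_def by blast
    then show ?thesis using True by simp
  next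
    case False
    define y where "y = (1 / norm x) *\<^sub>R x"
    have "y \<in> K" unfolding y_def using assms(2) x by (simp add: cone_def)
    then have y: "y \<in> S" using False unfolding S_def y_def by simp
    have "f (norm x *\<^sub>R y) = norm x * f y"
      using assms(3) \<open>y \<in> K\<close> unfolding cone_functional_def by simp
    then have "f x = norm x * f y" using False unfolding y_def by simp
    then show ?thesis using ab[OF y] mult_left_mono[of a "f y" "norm x"]
        mult_left_mono[of "f y" b "norm x"] by (simp add: mult.commute)
  qed
  then show ?thesis unfolding norm_comparable_def using a by blast
qed

end

theory Submission
  imports Defs
begin

text \<open>
  Let \<open>S\<^sub>k\<close> be the supremum of \<open>E log f (B x)\<close> over \<open>f x = 1\<close> and \<open>L\<^sub>k = E log \<parallel>B\<parallel>\<close>.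
  Homogeneity gives \<open>S\<^bsub>k+l\<^esub> \<le> S\<^sub>k + S\<^sub>l\<close>, so \<open>S\<^sub>k / k\<close> converges by Fekete's lemma. At an interior
  point \<open>x\<close> of the pointed cone, \<open>\<parallel>B\<parallel> \<le> c \<parallel>B x\<parallel>\<close> uniformly over all operators \<open>B\<close> preserving the
  cone, so \<open>S\<^sub>k\<close> and \<open>L\<^sub>k\<close> differ by a bounded amount. For an invariant functional \<open>\<phi>\<close>, the quantity
  \<open>E log \<phi> (B x) - log \<phi> x\<close> does not depend on \<open>x\<close>; as \<open>f\<close> and \<open>\<phi>\<close> are comparable,
  \<open>E log f (B x)\<close> varies by a bounded amount, uniformly in \<open>k\<close>, over all \<open>x\<close> with \<open>f x = 1\<close>.
\<close>

section \<open>Extended reals and the logarithm\<close>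

text \<open>A finite nonnegative factor respects the convention that \<infinity> plus -\<infinity>
  is \<infinity>, so infinite summands of opposite sign cause no failure.\<close>

lemma ereal_times_add_distrib:
  fixes a b :: ereal
  assumes "0 \<le> r"
  shows "ereal r * (a + b) = ereal r * a + ereal r * b"
  using assms by (cases "r = 0"; cases a; cases b) (auto simp: algebra_simps)

lemma elog_mult:
  assumes "0 \<le> x" "0 < c"
  shows "elog (c * x) = elog x + ereal (ln c)"
  using assms by (auto simp: elog_def ln_mult)

lemma elog_mono:
  assumes "0 \<le> x" "x \<le> y"
  shows "elog x \<le> elog y"
  using assms by (auto simp: elog_def)

lemma elog_le_add_ln:
  assumes "0 \<le> x" "0 < c" "0 \<le> y" "x \<le> c * y"
  shows "elog x \<le> elog y + ereal (ln c)"
  using elog_mono[OF assms(1,4)] elog_mult[OF assms(3,2)] by simp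

lemma elog_not_infty [simp]: "elog x \<noteq> \<infinity>"
  by (simp add: elog_def)

lemma tendsto_ereal_divide_nat: "(\<lambda>n. ereal (c / real n)) \<longlonglongrightarrow> 0"
proof -
  have "(\<lambda>n. c / real n) \<longlonglongrightarrow> 0" by (rule lim_const_over_n)
  then show ?thesis by (simp add: zero_ereal_def)
qed

lemma tendsto_average_add_const:
  fixes X :: "nat \<Rightarrow> ereal"
  assumes "(\<lambda>n. ereal (1 / real n) * X n) \<longlonglongrightarrow> l"
  shows "(\<lambda>n. ereal (1 / real n) * (X n + ereal c)) \<longlonglongrightarrow> l"
proof -
  have "(\<lambda>n. ereal (1 / real n) * X n + ereal (c / real n)) \<longlonglongrightarrow> l + 0"
    by (rule tendsto_add_ereal_general[OF _ assms tendsto_ereal_divide_nat]) auto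
  then show ?thesis by (simp add: ereal_times_add_distrib)
qed

text \<open>A sandwich between averages of \<open>X\<close> shifted by constants, whose effect is of
  order 1/n. Two additive bounds replace a bound on a difference, since both sequences may take the
  value -\<infinity>.\<close>

lemma tendsto_average_bounded_difference:
  fixes X Y :: "nat \<Rightarrow> ereal"
  assumes lim: "(\<lambda>n. ereal (1 / real n) * X n) \<longlonglongrightarrow> l"
    and XY: "\<And>n. X n \<le> Y n + ereal c" and YX: "\<And>n. Y n \<le> X n + ereal d"
  shows "(\<lambda>n. ereal (1 / real n) * Y n) \<longlonglongrightarrow> l"
proof (rule tendsto_sandwich)
  have "X n + ereal (- c) \<le> Y n" for n
    using XY[of n] by (cases "X n"; cases "Y n") auto
  then show "\<forall>\<^sub>F n in sequentially. ereal (1 / real n) * (X n + ereal (- c)) \<le> ereal (1 / real n) * Y n"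
    by (intro always_eventually allI ereal_mult_left_mono) auto
  show "\<forall>\<^sub>F n in sequentially. ereal (1 / real n) * Y n \<le> ereal (1 / real n) * (X n + ereal d)"
    using YX by (intro always_eventually allI ereal_mult_left_mono) auto
qed (rule tendsto_average_add_const[OF lim])+

text \<open>Fekete's lemma for sequences that may take the value -\<infinity>: the averages tend to
  their infimum \<open>I\<close> over positive indices, which may itself be -\<infinity>.\<close>

lemma fekete_ereal:
  fixes a :: "nat \<Rightarrow> ereal"
  assumes sub: "\<And>k l. a (k + l) \<le> a k + a l" and fin: "\<And>k. a k < \<infinity>"
  shows "convergent (\<lambda>n. ereal (1 / real n) * a n)"
proof -
  define I where "I = (INF n\<in>{1..}. ereal (1 / real n) * a n)"
  have "(\<lambda>n. ereal (1 / real n) * a n) \<longlonglongrightarrow> I"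
  proof (rule order_tendstoI)
    fix c assume "c < I"
    then have "c < ereal (1 / real n) * a n" if "n \<ge> 1" for n
      using that unfolding I_def by (auto intro: less_le_trans INF_lower)
    then show "\<forall>\<^sub>F n in sequentially. c < ereal (1 / real n) * a n"
      using eventually_ge_at_top[of 1] by (rule eventually_mono[rotated])
  next
    fix c assume "I < c"
    then obtain k where k: "k \<ge> 1" "ereal (1 / real k) * a k < c"
      unfolding I_def by (auto simp: INF_less_iff)
    \<comment> \<open>A real \<open>c'\<close> strictly in between serves as a finite slope even
      when \<open>a k\<close> is -\<infinity>, and leaves room below \<open>c\<close> for the error
      term.\<close>
    then obtain c' where c': "ereal (1 / real k) * a k < ereal c'" "ereal c' < c"
      using ereal_dense2 by blast
    have ak: "a k \<le> ereal (real k * c')"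
      using c'(1) k(1) fin[of k] by (cases "a k") (auto simp: field_simps)
    have mult: "a (q * k + r) \<le> ereal (real q * (real k * c')) + a r" for q r
    proof (induction q)
      case (Suc q)
      have "a (Suc q * k + r) \<le> a k + a (q * k + r)"
        using sub[of k "q * k + r"] by (simp add: add.assoc)
      also have "\<dots> \<le> ereal (real k * c') + (ereal (real q * (real k * c')) + a r)"
        using ak Suc by (rule add_mono)
      also have "\<dots> = ereal (real (Suc q) * (real k * c')) + a r"
        by (cases "a r") (auto simp: algebra_simps)
      finally show ?case .
    qed auto
    have "\<exists>M::real. \<forall>r<j. a r \<le> ereal M" for j
    proof (induction j)
      case (Suc j)
      then obtain M where M: "\<And>r. r < j \<Longrightarrow> a r \<le> ereal M" by blast
      obtain N where "a j \<le> ereal N" using fin[of j] by (cases "a j") auto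
      then have "a r \<le> ereal (max M N)" if "r < Suc j" for r
        using M[of r] that order_trans[of "a r" _ "ereal (max M N)"] by (cases "r = j") auto
      then show ?case by blast
    qed auto
    then obtain M where M: "\<And>r. r < k \<Longrightarrow> a r \<le> ereal M" by blast
    \<comment> \<open>Division of n by \<open>k\<close> costs two errors: the value of
      \<open>a\<close> at the remainder, at most \<open>M\<close>, and the slope \<open>c'\<close>
      missing on fewer than \<open>k\<close> indices.\<close>
    define D where "D = \<bar>M\<bar> + real k * \<bar>c'\<bar>"
    have bound: "ereal (1 / real n) * a n \<le> ereal (c' + D / real n)" if "n \<ge> 1" for n
    proof -
      have "a n \<le> ereal (real (n div k) * (real k * c')) + ereal M"
        using mult[of "n div k" "n mod k"] k(1)
          add_left_mono[OF M[of "n mod k"], of "ereal (real (n div k) * (real k * c'))"]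
        by (auto intro: order_trans)
      also have "\<dots> = ereal ((real n - real (n mod k)) * c' + M)"
      proof -
        have "real n = real (n div k) * real k + real (n mod k)"
          by (metis div_mult_mod_eq of_nat_add of_nat_mult)
        then show ?thesis by (simp add: algebra_simps)
      qed
      also have "\<dots> \<le> ereal (real n * c' + D)"
      proof -
        have "- (real (n mod k) * c') \<le> real (n mod k) * \<bar>c'\<bar>"
          using mult_left_mono[of "- c'" "\<bar>c'\<bar>" "real (n mod k)"] by simp
        also have "\<dots> \<le> real k * \<bar>c'\<bar>"
          using k(1) by (intro mult_right_mono) auto
        finally show ?thesis by (simp add: D_def algebra_simps)
      qed
      finally have "ereal (1 / real n) * a n \<le> ereal (1 / real n) * ereal (real n * c' + D)"
        by (intro ereal_mult_left_mono) auto
      then show ?thesis using that by (simp add: add_divide_distrib)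
    qed
    have "(\<lambda>n. ereal c' + ereal (D / real n)) \<longlonglongrightarrow> ereal c' + 0"
      by (rule tendsto_add_ereal_general[OF _ tendsto_const tendsto_ereal_divide_nat]) auto
    then have "\<forall>\<^sub>F n in sequentially. ereal c' + ereal (D / real n) < c"
      using c'(2) by (intro order_tendstoD(2)) auto
    then show "\<forall>\<^sub>F n in sequentially. ereal (1 / real n) * a n < c"
      using eventually_ge_at_top[of 1] by eventually_elim (auto intro: le_less_trans[OF bound])
  qed
  then show ?thesis by (rule convergentI)
qed

section \<open>Expectations over products\<close>

lemma expect_prod_0 [simp]: "expect_prod m p A 0 g = g id"
proof -
  have "{w. length w = 0 \<and> set w \<subseteq> {1..m}} = {[]}" by auto
  then show ?thesis by (simp add: expect_prod_def flip: one_ereal_def id_def)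
qed

lemma finite_words: "finite {w :: nat list. length w = k \<and> set w \<subseteq> {1..m}}"
  using finite_lists_length_eq[of "{1..m}" k] by (simp add: conj_commute)

locale random_product =
  fixes m :: nat and p :: "nat \<Rightarrow> real" and A :: "nat \<Rightarrow> 'a::euclidean_space \<Rightarrow> 'a"
  assumes p_pos: "\<And>j. j \<in> {1..m} \<Longrightarrow> p j > 0" and p_sum: "(\<Sum>j=1..m. p j) = 1"
begin

lemma expect_prod_less_infty:
  assumes "\<And>w. g (fold A w) < \<infinity>"
  shows "expect_prod m p A k g < \<infinity>"
proof -
  have "ereal (prod_list (map p w)) * g (fold A w) \<noteq> \<infinity>" if "set w \<subseteq> {1..m}" for w
  proof -
    have "prod_list (map p w) > 0"
      using that p_pos by (induction w) auto
    then show ?thesis using assms[of w] by (cases "g (fold A w)") auto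
  qed
  then show ?thesis
    unfolding expect_prod_def less_top[symmetric] top_ereal_def[symmetric]
    by (auto simp: sum_Pinfty top_ereal_def)
qed

text \<open>The head of a word acts first under \<open>fold\<close>, so the innermost factor is
  split off. Evaluated at a point x, this moves the start to \<open>A j x\<close>, which drives all
  later inductions on the length.\<close>

lemma expect_prod_Suc:
  "expect_prod m p A (Suc k) g =
     (\<Sum>j=1..m. ereal (p j) * expect_prod m p A k (\<lambda>B. g (B \<circ> A j)))"
proof -
  let ?W = "{w :: nat list. length w = k \<and> set w \<subseteq> {1..m}}"
  have W: "{w. length w = Suc k \<and> set w \<subseteq> {1..m}} = (\<lambda>(j, w). j # w) ` ({1..m} \<times> ?W)"
    by (auto simp: length_Suc_conv image_iff)
  have left: "ereal r * (\<Sum>w\<in>?W. h w) = (\<Sum>w\<in>?W. ereal r * h w)" if "0 \<le> r" for r h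
    using finite_words[of k m] by (induction rule: finite_induct)
      (auto simp: ereal_times_add_distrib that)
  have "expect_prod m p A (Suc k) g =
      (\<Sum>(j, w)\<in>{1..m} \<times> ?W. ereal (p j * prod_list (map p w)) * g (fold A w \<circ> A j))"
    unfolding expect_prod_def W by (subst sum.reindex) (auto simp: inj_on_def case_prod_unfold)
  also have "\<dots> = (\<Sum>j=1..m. \<Sum>w\<in>?W. ereal (p j * prod_list (map p w)) * g (fold A w \<circ> A j))"
    by (simp add: sum.cartesian_product)
  also have "\<dots> = (\<Sum>j=1..m. ereal (p j) * expect_prod m p A k (\<lambda>B. g (B \<circ> A j)))"
    unfolding expect_prod_def
  proof (rule sum.cong)
    fix j assume "j \<in> {1..m}"
    then have "0 \<le> p j" using p_pos by (simp add: less_imp_le)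
    then show "(\<Sum>w\<in>?W. ereal (p j * prod_list (map p w)) * g (fold A w \<circ> A j)) =
        ereal (p j) * (\<Sum>w\<in>?W. ereal (prod_list (map p w)) * g (fold A w \<circ> A j))"
      by (simp only: left mult.assoc flip: times_ereal.simps(1))
  qed simp
  finally show ?thesis .
qed

lemma weighted_sum_const: "(\<Sum>j=1..m. ereal (p j) * s) = s"
proof -
  have "(\<Sum>j=1..m. ereal (p j) * s) = (\<Sum>j=1..m. ereal (p j)) * s"
    using p_pos by (intro sum_ereal_left_distrib[symmetric]) (auto simp: less_imp_le)
  also have "(\<Sum>j=1..m. ereal (p j)) = 1"
    using p_sum by simp
  finally show ?thesis by simp
qed

text \<open>The weights sum to 1, so a constant passes through the average; \<open>s\<close> may be
  infinite, as happens with invariant functionals.\<close>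

lemma weighted_sum_add_const:
  "(\<Sum>j=1..m. ereal (p j) * (h j + s)) = (\<Sum>j=1..m. ereal (p j) * h j) + s"
proof -
  have "(\<Sum>j=1..m. ereal (p j) * (h j + s)) = (\<Sum>j=1..m. ereal (p j) * h j + ereal (p j) * s)"
    using p_pos by (intro sum.cong refl ereal_times_add_distrib) (auto simp: less_imp_le)
  then show ?thesis by (simp only: sum.distrib weighted_sum_const)
qed

lemma weighted_sum_mono:
  assumes "\<And>j. j \<in> {1..m} \<Longrightarrow> h j \<le> h' j"
  shows "(\<Sum>j=1..m. ereal (p j) * h j) \<le> (\<Sum>j=1..m. ereal (p j) * h' j)"
  using assms p_pos by (intro sum_mono ereal_mult_left_mono) (auto simp: less_imp_le)

lemma expect_prod_const: "expect_prod m p A k (\<lambda>B. s) = s"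
  by (induction k) (simp_all add: expect_prod_Suc weighted_sum_const del: One_nat_def)

lemma expect_prod_add_const:
  "expect_prod m p A k (\<lambda>B. g B + s) = expect_prod m p A k g + s"
  by (induction k arbitrary: g) (simp_all add: expect_prod_Suc weighted_sum_add_const del: One_nat_def)

text \<open>The comparison is required only along words over the index set, so linearity and
  invariance of the cone are at hand for each product.\<close>

lemma expect_prod_mono:
  assumes "\<And>w. set w \<subseteq> {1..m} \<Longrightarrow> g (fold A w) \<le> g' (fold A w)"
  shows "expect_prod m p A k g \<le> expect_prod m p A k g'"
  unfolding expect_prod_def
proof (intro sum_mono ereal_mult_left_mono assms)
  fix w assume w: "w \<in> {w. length w = k \<and> set w \<subseteq> {1..m}}"
  then have "set w \<subseteq> {1..m}" by simp
  then show "0 \<le> ereal (prod_list (map p w))"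
    using p_pos by (induction w) (auto intro!: mult_nonneg_nonneg simp: less_imp_le)
qed auto

end

section \<open>Operators leaving a cone invariant\<close>

text \<open>Normality of a closed pointed cone: its unit slice is compact and disjoint from the
  negative cone, hence at a positive distance d from it. Rescaling turns this into the bound with
  \<open>M\<close> equal to 1/d.\<close>

lemma cone_normal:
  fixes K :: "'a::euclidean_space set"
  assumes "solid_pointed_cone K"
  obtains M where "M > 0" "\<And>u v. u \<in> K \<Longrightarrow> v \<in> K \<Longrightarrow> norm u \<le> M * norm (u + v)"
proof -
  have K: "closed K" "cone K" "K \<inter> uminus ` K = {0}"
    using assms by (auto simp: solid_pointed_cone_def)
  have "compact (K \<inter> sphere 0 1)" "closed (uminus ` K)"
    using K(1) by (auto intro: closed_Int_compact closed_negations)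
  moreover have "(K \<inter> sphere 0 1) \<inter> uminus ` K = {}"
  proof -
    have "(K \<inter> sphere 0 1) \<inter> uminus ` K = sphere 0 1 \<inter> (K \<inter> uminus ` K)"
      by (rule set_eqI) (simp only: Int_iff conj_ac)
    then show ?thesis unfolding K(3) by simp
  qed
  ultimately obtain d where d: "d > 0"
    "\<And>u v. u \<in> K \<inter> sphere 0 1 \<Longrightarrow> v \<in> uminus ` K \<Longrightarrow> d \<le> dist u v"
    using separate_compact_closed[of "K \<inter> sphere 0 1" "uminus ` K"] by blast
  have "norm u \<le> (1 / d) * norm (u + v)" if uv: "u \<in> K" "v \<in> K" for u v
  proof (cases "u = 0")
    case False
    let ?t = "1 / norm u"
    have "?t *\<^sub>R u \<in> K" "?t *\<^sub>R v \<in> K"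
      using K(2) uv by (auto simp: cone_def)
    then have "d \<le> dist (?t *\<^sub>R u) (- (?t *\<^sub>R v))"
      using False by (intro d(2)) auto
    also have "\<dots> = norm (?t *\<^sub>R (u + v))"
      by (simp only: dist_norm diff_minus_eq_add scaleR_add_right)
    also have "\<dots> = ?t * norm (u + v)" by simp
    finally show ?thesis using d(1) False by (simp add: field_simps)
  qed (use d(1) in simp)
  then show thesis using that[of "1 / d"] d(1) by simp
qed

text \<open>One interior point tests the size of every operator preserving the cone, with a constant
  independent of the operator. This gives lower bounds for all products at once.\<close>

lemma onorm_le_norm_interior:
  fixes K :: "'a::euclidean_space set"
  assumes "solid_pointed_cone K"
  obtains x c where "x \<in> K" "x \<noteq> 0" "c > 0"
    "\<And>B. linear B \<Longrightarrow> B ` K \<subseteq> K \<Longrightarrow> onorm B \<le> c * norm (B x)"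
proof -
  obtain M where M: "M > 0" "\<And>u v. u \<in> K \<Longrightarrow> v \<in> K \<Longrightarrow> norm u \<le> M * norm (u + v)"
    using cone_normal[OF assms] by blast
  obtain x where "x \<in> interior K"
    using assms by (auto simp: solid_pointed_cone_def)
  then obtain r where r: "r > 0" "cball x r \<subseteq> K"
    by (auto simp: mem_interior_cball)
  have xK: "x \<in> K" using r by auto
  \<comment> \<open>For \<open>\<parallel>z\<parallel> = r\<close>, both \<open>B (x \<plusminus> z)\<close> lie in the cone and add up to \<open>2 B x\<close>, so normality bounds
    their difference \<open>2 B z\<close>.\<close>
  have bound: "onorm B \<le> (2 * M / r) * norm (B x)" if B: "linear B" "B ` K \<subseteq> K" for B
  proof (rule onorm_le)
    fix y
    show "norm (B y) \<le> (2 * M / r) * norm (B x) * norm y"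
    proof (cases "y = 0")
      case False
      define z where "z = (r / norm y) *\<^sub>R y"
      have z: "norm z = r" using False r(1) by (simp add: z_def)
      then have "x + z \<in> K" "x - z \<in> K"
        using r by (auto simp: subset_iff dist_norm)
      then have uv: "B (x + z) \<in> K" "B (x - z) \<in> K"
        using B(2) by auto
      have sum: "B (x + z) + B (x - z) = 2 *\<^sub>R B x"
        and diff: "B (x + z) - B (x - z) = 2 *\<^sub>R B z"
        by (simp_all add: linear_add[OF B(1)] linear_diff[OF B(1)] scaleR_2)
      have "2 * norm (B z) \<le> norm (B (x + z)) + norm (B (x - z))"
        using norm_triangle_ineq4[of "B (x + z)" "B (x - z)"] by (simp add: diff)
      also have "\<dots> \<le> M * (2 * norm (B x)) + M * (2 * norm (B x))"
        using M(2)[OF uv] M(2)[OF uv(2,1)] sum by (intro add_mono) (simp_all add: add.commute)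
      finally have "norm (B z) \<le> 2 * M * norm (B x)" by simp
      moreover have "norm (B z) = r / norm y * norm (B y)"
        using r(1) by (simp add: z_def linear_scale[OF B(1)])
      ultimately show ?thesis using False r(1) by (simp add: field_simps)
    qed (simp add: linear_0[OF B(1)])
  qed
  \<comment> \<open>At the origin the bound would force the identity, which preserves the cone, to
    have norm 0.\<close>
  have "x \<noteq> 0"
  proof
    assume "x = 0"
    then have "onorm (id :: 'a \<Rightarrow> 'a) \<le> 0"
      using bound[of id] by (simp add: linear_id)
    then show False using onorm_id[where 'a = 'a] by (simp add: id_def)
  qed
  then show thesis using that[of x "2 * M / r"] xK M(1) r(1) bound by simp
qed

lemma norm_comparable_functionals:
  assumes "norm_comparable K f" "norm_comparable K \<phi>"
  obtains c where "c > 0" "\<And>x. x \<in> K \<Longrightarrow> \<phi> x \<le> c * f x"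
proof -
  obtain a b where a: "a > 0" "\<And>x. x \<in> K \<Longrightarrow> a * norm x \<le> f x"
    using assms(1) by (auto simp: norm_comparable_def)
  obtain b where b: "\<And>x. x \<in> K \<Longrightarrow> \<phi> x \<le> b * norm x"
    using assms(2) by (auto simp: norm_comparable_def)
  \<comment> \<open>The comparison passes through the norm. The upper constant \<open>b\<close>
    carries no sign, and \<open>\<bar>b\<bar> + 1\<close> makes the factor positive, so that its
    logarithm can be used.\<close>
  have "\<phi> x \<le> ((\<bar>b\<bar> + 1) / a) * f x" if "x \<in> K" for x
  proof -
    have "\<phi> x \<le> (\<bar>b\<bar> + 1) * norm x"
      using b[OF that] by (rule order_trans) (intro mult_right_mono, auto)
    also have "\<dots> = ((\<bar>b\<bar> + 1) / a) * (a * norm x)"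
      using a(1) by simp
    also have "\<dots> \<le> ((\<bar>b\<bar> + 1) / a) * f x"
      using a(1) by (intro mult_left_mono a(2)[OF that]) auto
    finally show ?thesis .
  qed
  moreover have "(\<bar>b\<bar> + 1) / a > 0" using a(1) by simp
  ultimately show thesis using that by blast
qed

lemma norm_comparable_norm: "norm_comparable K norm"
  unfolding norm_comparable_def by (rule exI[of _ 1], simp, rule exI[of _ 1], simp)

section \<open>Invariant functionals along products of cone-preserving operators\<close>

locale random_product_cone = random_product m p A
  for m :: nat and p :: "nat \<Rightarrow> real" and A :: "nat \<Rightarrow> 'a::euclidean_space \<Rightarrow> 'a" +
  fixes K :: "'a set"
  assumes A_linear: "\<And>j. j \<in> {1..m} \<Longrightarrow> linear (A j)"
    and A_K: "\<And>j. j \<in> {1..m} \<Longrightarrow> A j ` K \<subseteq> K"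
    and K: "solid_pointed_cone K"
begin

lemma fold_linear: "set w \<subseteq> {1..m} \<Longrightarrow> linear (fold A w)"
  by (induction w) (auto intro!: linear_compose A_linear simp: linear_id simp flip: id_def)

lemma fold_cone: "set w \<subseteq> {1..m} \<Longrightarrow> fold A w ` K \<subseteq> K"
  using A_K by (induction w) (auto simp: image_subset_iff)

text \<open>The constant may be \<open>- \<infinity>\<close>; the statement includes \<open>x = 0\<close>, where both sides are \<open>- \<infinity>\<close>, so that
  the induction over \<open>k\<close> survives operators that vanish at points of the cone.\<close>

lemma expect_prod_invariant:
  assumes \<phi>: "cone_functional K \<phi>" and inv: "invariant_for m p A K \<phi>"
  shows "\<exists>c. \<forall>x\<in>K. expect_prod m p A k (\<lambda>B. elog (\<phi> (B x))) = elog (\<phi> x) + c"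
proof -
  have \<phi>0: "\<phi> 0 = 0" if "0 \<in> K"
    using \<phi> that unfolding cone_functional_def by (metis mult_zero_left order_refl scaleR_zero_left)
  obtain c where c: "\<And>x. x \<in> K - {0} \<Longrightarrow>
      - elog (\<phi> x) + (\<Sum>j=1..m. ereal (p j) * elog (\<phi> (A j x))) = c"
    using inv unfolding invariant_for_def constant_on_def by blast
  have step: "(\<Sum>j=1..m. ereal (p j) * elog (\<phi> (A j x))) = elog (\<phi> x) + c" if "x \<in> K" "x \<noteq> 0" for x
  proof -
    have "\<phi> x > 0" using \<phi> that by (auto simp: cone_functional_def)
    then have "elog (\<phi> x) = ereal (ln (\<phi> x))" by (simp add: elog_def)
    then show ?thesis using c[of x] that
      by (cases "(\<Sum>j=1..m. ereal (p j) * elog (\<phi> (A j x)))") auto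
  qed
  \<comment> \<open>Otherwise -\<infinity> plus \<open>c\<close> would be \<infinity> and the claim
    would fail at the origin. The one-step expectation at a nonzero point excludes this.\<close>
  have not_infty: "c \<noteq> \<infinity>"
  proof -
    obtain x where x: "x \<in> K" "x \<noteq> 0"
      using onorm_le_norm_interior[OF K] by metis
    have "expect_prod m p A (Suc 0) (\<lambda>B. elog (\<phi> (B x))) < \<infinity>"
      by (intro expect_prod_less_infty) simp
    then have "elog (\<phi> x) + c < \<infinity>"
      by (simp only: expect_prod_Suc expect_prod_0 o_apply id_apply step[OF x])
    then show ?thesis by auto
  qed
  \<comment> \<open>The induction hypothesis must also exclude the constant \<infinity>, for the
    same reason at the origin.\<close>
  have "\<exists>c'. c' \<noteq> \<infinity> \<and> (\<forall>x\<in>K. expect_prod m p A k (\<lambda>B. elog (\<phi> (B x))) = elog (\<phi> x) + c')"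
  proof (induction k)
    case 0
    show ?case by (rule exI[of _ 0]) simp
  next
    case (Suc k)
    then obtain c' where c': "c' \<noteq> \<infinity>"
      "\<And>x. x \<in> K \<Longrightarrow> expect_prod m p A k (\<lambda>B. elog (\<phi> (B x))) = elog (\<phi> x) + c'" by blast
    have "expect_prod m p A (Suc k) (\<lambda>B. elog (\<phi> (B x))) = elog (\<phi> x) + (c + c')"
      if x: "x \<in> K" for x
    proof -
      have "expect_prod m p A (Suc k) (\<lambda>B. elog (\<phi> (B x))) =
          (\<Sum>j=1..m. ereal (p j) * (elog (\<phi> (A j x)) + c'))"
        unfolding expect_prod_Suc o_apply using A_K x
        by (intro sum.cong refl) (auto simp: c'(2) image_subset_iff)
      also have "\<dots> = (\<Sum>j=1..m. ereal (p j) * elog (\<phi> (A j x))) + c'"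
        by (rule weighted_sum_add_const)
      also have "\<dots> = elog (\<phi> x) + c + c'"
      proof (cases "x = 0")
        case True
        have "(\<Sum>j=1..m. ereal (p j) * elog (\<phi> (A j x))) = (\<Sum>j=1..m. ereal (p j) * - \<infinity>)"
          using x True by (intro sum.cong refl) (simp add: linear_0[OF A_linear] \<phi>0 elog_def)
        also have "\<dots> = - \<infinity>" by (rule weighted_sum_const)
        moreover have "elog (\<phi> x) = - \<infinity>"
          using x True by (simp add: \<phi>0 elog_def)
        ultimately show ?thesis
          using not_infty c'(1) by (cases c; cases c') simp_all
      qed (simp only: step x not_False_eq_True)
      finally show ?thesis by (simp add: add.assoc)
    qed
    moreover have "c + c' \<noteq> \<infinity>" using not_infty c'(1) by simp
    ultimately show ?case by blast
  qed
  then show ?thesis by blast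
qed

end

section \<open>Growth of a functional compared with growth of the operator norm\<close>

locale random_product_functional = random_product_cone m p A K
  for m :: nat and p :: "nat \<Rightarrow> real" and A :: "nat \<Rightarrow> 'a::euclidean_space \<Rightarrow> 'a"
    and K :: "'a set" +
  fixes f :: "'a \<Rightarrow> real"
  assumes f: "cone_functional K f" and f_comp: "norm_comparable K f"
begin

abbreviation expect_log :: "nat \<Rightarrow> 'a \<Rightarrow> ereal" where
  "expect_log k x \<equiv> expect_prod m p A k (\<lambda>B. elog (f (B x)))"

abbreviation sup_log :: "nat \<Rightarrow> ereal" where
  "sup_log k \<equiv> (SUP x\<in>{x\<in>K. f x = 1}. expect_log k x)"

abbreviation norm_log :: "nat \<Rightarrow> ereal" where
  "norm_log k \<equiv> expect_prod m p A k (\<lambda>B. elog (onorm B))"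

lemma functional_nonneg: "x \<in> K \<Longrightarrow> 0 \<le> f x"
  and functional_pos: "x \<in> K \<Longrightarrow> x \<noteq> 0 \<Longrightarrow> 0 < f x"
  and functional_scale: "x \<in> K \<Longrightarrow> 0 \<le> t \<Longrightarrow> f (t *\<^sub>R x) = t * f x"
  using f by (auto simp: cone_functional_def)

text \<open>On the level set f = 1 the norm of x is bounded, so f(Bx) is at most a fixed multiple of
  the norm of B. Taking logarithms leaves an additive constant independent of k and x.\<close>

lemma expect_log_upper:
  obtains C where "\<And>k x. x \<in> K \<Longrightarrow> f x = 1 \<Longrightarrow> expect_log k x \<le> norm_log k + ereal C"
proof -
  obtain b where b: "b > 0" "\<And>x. x \<in> K \<Longrightarrow> f x \<le> b * norm x"
    using norm_comparable_functionals[OF norm_comparable_norm f_comp] by blast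
  obtain a where a: "a > 0" "\<And>x. x \<in> K \<Longrightarrow> norm x \<le> a * f x"
    using norm_comparable_functionals[OF f_comp norm_comparable_norm] by blast
  have "expect_log k x \<le> norm_log k + ereal (ln (b * a))" if x: "x \<in> K" "f x = 1" for k x
  proof -
    have "elog (f (fold A w x)) \<le> elog (onorm (fold A w)) + ereal (ln (b * a))"
      if w: "set w \<subseteq> {1..m}" for w
    proof (rule elog_le_add_ln)
      have wx: "fold A w x \<in> K" using fold_cone[OF w] x(1) by auto
      have lin: "bounded_linear (fold A w)"
        using fold_linear[OF w] by (simp add: linear_conv_bounded_linear)
      show "0 \<le> f (fold A w x)" using functional_nonneg[OF wx] .
      show "0 \<le> onorm (fold A w)" using onorm_pos_le[OF lin] .
      have "f (fold A w x) \<le> b * (onorm (fold A w) * norm x)"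
        using b(2)[OF wx] mult_left_mono[OF onorm[OF lin, of x], of b] b(1) by linarith
      also have "\<dots> \<le> b * (onorm (fold A w) * a)"
        using a(2)[OF x(1)] x(2) b(1) onorm_pos_le[OF lin] by (intro mult_left_mono) auto
      finally show "f (fold A w x) \<le> b * a * onorm (fold A w)" by (simp add: ac_simps)
    qed (use a b in simp)
    then have "expect_log k x \<le> expect_prod m p A k (\<lambda>B. elog (onorm B) + ereal (ln (b * a)))"
      by (intro expect_prod_mono)
    then show ?thesis by (simp add: expect_prod_add_const)
  qed
  then show thesis using that by blast
qed

text \<open>An interior point, rescaled to the level set, yields a single \<open>x\<close> and a
  single \<open>C\<close> for all lengths k.\<close>

lemma expect_log_lower:
  obtains x C where "x \<in> K" "f x = 1" "\<And>k. norm_log k \<le> expect_log k x + ereal C"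
proof -
  obtain y c where y: "y \<in> K" "y \<noteq> 0" "c > 0"
    "\<And>B. linear B \<Longrightarrow> B ` K \<subseteq> K \<Longrightarrow> onorm B \<le> c * norm (B y)"
    using onorm_le_norm_interior[OF K] by metis
  obtain a where a: "a > 0" "\<And>x. x \<in> K \<Longrightarrow> norm x \<le> a * f x"
    using norm_comparable_functionals[OF f_comp norm_comparable_norm] by blast
  have fy: "f y > 0" using functional_pos y by blast
  define x where "x = (1 / f y) *\<^sub>R y"
  have x: "x \<in> K" "f x = 1"
    using K y fy by (auto simp: x_def functional_scale solid_pointed_cone_def cone_def)
  have "norm_log k \<le> expect_log k x + ereal (ln (c * a * f y))" for k
  proof -
    have "elog (onorm (fold A w)) \<le> elog (f (fold A w x)) + ereal (ln (c * a * f y))"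
      if w: "set w \<subseteq> {1..m}" for w
    proof (rule elog_le_add_ln)
      have wy: "fold A w y \<in> K" and wx: "fold A w x \<in> K" using fold_cone[OF w] x(1) y(1) by auto
      have lin: "bounded_linear (fold A w)"
        using fold_linear[OF w] by (simp add: linear_conv_bounded_linear)
      show "0 \<le> f (fold A w x)" using functional_nonneg[OF wx] .
      show "0 \<le> onorm (fold A w)" using onorm_pos_le[OF lin] .
      have "onorm (fold A w) \<le> c * (a * f (fold A w y))"
        using y(4)[OF fold_linear[OF w] fold_cone[OF w]]
          mult_left_mono[OF a(2)[OF wy], of c] y(3) by linarith
      also have "f (fold A w y) = f y * f (fold A w x)"
        using fy wy by (simp add: x_def linear_scale[OF fold_linear[OF w]] functional_scale)
      finally show "onorm (fold A w) \<le> c * a * f y * f (fold A w x)" by (simp add: ac_simps)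
    qed (use a y fy in simp)
    then have "norm_log k \<le> expect_prod m p A k (\<lambda>B. elog (f (B x)) + ereal (ln (c * a * f y)))"
      by (intro expect_prod_mono)
    then show ?thesis by (simp add: expect_prod_add_const)
  qed
  then show thesis using that x by blast
qed

lemma sup_log_upper:
  obtains C where "\<And>k. sup_log k \<le> norm_log k + ereal C"
proof -
  obtain C where "\<And>k x. x \<in> K \<Longrightarrow> f x = 1 \<Longrightarrow> expect_log k x \<le> norm_log k + ereal C"
    using expect_log_upper by blast
  then have "sup_log k \<le> norm_log k + ereal C" for k
    by (intro SUP_least) auto
  then show thesis using that by blast
qed

lemma sup_log_lower:
  obtains C where "\<And>k. norm_log k \<le> sup_log k + ereal C"
proof -
  obtain x C where x: "x \<in> K" "f x = 1" "\<And>k. norm_log k \<le> expect_log k x + ereal C"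
    using expect_log_lower by blast
  have "expect_log k x \<le> sup_log k" for k
    using x by (intro SUP_upper) auto
  then have "norm_log k \<le> sup_log k + ereal C" for k
    using x(3) by (meson add_right_mono order_trans)
  then show thesis using that by blast
qed

text \<open>The supremum runs over infinitely many points, so finiteness comes from
  \<open>norm_log\<close>, a finite average of terms below \<infinity>. Fekete's lemma requires
  it.\<close>

lemma sup_log_less_infty: "sup_log k < \<infinity>"
proof -
  obtain C where C: "\<And>k. sup_log k \<le> norm_log k + ereal C"
    using sup_log_upper by blast
  have "norm_log k < \<infinity>"
    by (intro expect_prod_less_infty) simp
  then have "norm_log k + ereal C < \<infinity>" by (cases "norm_log k") auto
  then show ?thesis using C[of k] by (rule le_less_trans[rotated])
qed

text \<open>Homogeneity carries the bound from the level set to the whole cone. The origin is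
  included because an operator may annihilate a nonzero point of the cone.\<close>

lemma expect_log_le_sup_log:
  assumes x: "x \<in> K"
  shows "expect_log k x \<le> elog (f x) + sup_log k"
proof (cases "x = 0")
  case True
  have "f 0 = 0" using functional_scale[of 0 0] x True by simp
  then have "elog (f (fold A w x)) \<le> - \<infinity>" if "set w \<subseteq> {1..m}" for w
    using True by (simp add: linear_0[OF fold_linear[OF that]] elog_def)
  then have "expect_log k x \<le> expect_prod m p A k (\<lambda>B. - \<infinity>)"
    by (intro expect_prod_mono)
  then show ?thesis by (simp add: expect_prod_const)
next
  case False
  have fx: "f x > 0" using functional_pos x False by blast
  define y where "y = (1 / f x) *\<^sub>R x"
  have y: "y \<in> K" "f y = 1"
    using K x fx by (auto simp: y_def functional_scale solid_pointed_cone_def cone_def)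
  have "elog (f (fold A w x)) \<le> elog (f (fold A w y)) + ereal (ln (f x))"
    if w: "set w \<subseteq> {1..m}" for w
  proof -
    have wx: "fold A w x \<in> K" and wy: "fold A w y \<in> K" using fold_cone[OF w] x y(1) by auto
    then have "f (fold A w x) = f x * f (fold A w y)"
      using fx wx by (simp add: y_def linear_scale[OF fold_linear[OF w]] functional_scale)
    then show ?thesis using elog_mult fx functional_nonneg[OF wy] by simp
  qed
  then have "expect_log k x \<le> expect_prod m p A k (\<lambda>B. elog (f (B y)) + ereal (ln (f x)))"
    by (intro expect_prod_mono)
  also have "\<dots> = expect_log k y + ereal (ln (f x))"
    by (rule expect_prod_add_const)
  also have "\<dots> \<le> sup_log k + ereal (ln (f x))"
    using y by (intro add_right_mono SUP_upper) auto
  finally show ?thesis using fx by (simp add: elog_def add.commute)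
qed

text \<open>The last l factors act on the point reached after k steps and contribute at most
  \<open>sup_log l\<close>. The induction removes the first factor each time; its base case is the
  homogeneous bound.\<close>

lemma expect_log_add:
  assumes "x \<in> K"
  shows "expect_log (k + l) x \<le> expect_log k x + sup_log l"
  using assms
proof (induction k arbitrary: x)
  case 0
  then show ?case using expect_log_le_sup_log by simp
next
  case (Suc k)
  have "expect_log (Suc k + l) x = (\<Sum>j=1..m. ereal (p j) * expect_log (k + l) (A j x))"
    by (simp only: add_Suc expect_prod_Suc o_apply)
  also have "\<dots> \<le> (\<Sum>j=1..m. ereal (p j) * (expect_log k (A j x) + sup_log l))"
    using A_K Suc by (intro weighted_sum_mono) (auto simp: image_subset_iff)
  also have "\<dots> = expect_log (Suc k) x + sup_log l"
    by (simp only: weighted_sum_add_const expect_prod_Suc o_apply)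
  finally show ?case .
qed

lemma sup_log_subadditive: "sup_log (k + l) \<le> sup_log k + sup_log l"
proof (rule SUP_least)
  fix x assume x: "x \<in> {x \<in> K. f x = 1}"
  then have "expect_log (k + l) x \<le> expect_log k x + sup_log l"
    using expect_log_add by simp
  also have "\<dots> \<le> sup_log k + sup_log l"
    using x by (intro add_right_mono SUP_upper)
  finally show "expect_log (k + l) x \<le> sup_log k + sup_log l" .
qed

lemma F_max_tendsto: "F_max m p A K f \<longlonglongrightarrow> lyapunov_exponent m p A"
proof -
  have "convergent (\<lambda>k. ereal (1 / real k) * sup_log k)"
    by (rule fekete_ereal[OF sup_log_subadditive sup_log_less_infty])
  then obtain l where l: "(\<lambda>k. ereal (1 / real k) * sup_log k) \<longlonglongrightarrow> l"
    by (auto simp: convergent_def)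
  obtain C where C: "\<And>k. sup_log k \<le> norm_log k + ereal C"
    using sup_log_upper by blast
  obtain D where D: "\<And>k. norm_log k \<le> sup_log k + ereal D"
    using sup_log_lower by blast
  \<comment> \<open>Existence of the limit defining the Lyapunov exponent is obtained here too,
    transferred from \<open>sup_log\<close>.\<close>
  have "(\<lambda>k. ereal (1 / real k) * norm_log k) \<longlonglongrightarrow> l"
    by (rule tendsto_average_bounded_difference[OF l C D])
  then have "lyapunov_exponent m p A = l"
    unfolding lyapunov_exponent_def by (rule limI)
  then show ?thesis using l by (simp add: F_max_def[abs_def])
qed

text \<open>The lower bound known at one point spreads to the whole level set: for \<phi> the
  expectations at two points differ only through the starting values of \<phi>, and replacing f by
  \<phi> and back costs constants independent of k.\<close>

lemma invariant_expect_log_lower: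
  assumes \<phi>: "cone_functional K \<phi>" "norm_comparable K \<phi>" "invariant_for m p A K \<phi>"
  obtains C where "\<And>k x. x \<in> K \<Longrightarrow> f x = 1 \<Longrightarrow> norm_log k \<le> expect_log k x + ereal C"
proof -
  obtain x0 C where x0: "x0 \<in> K" "f x0 = 1" "\<And>k. norm_log k \<le> expect_log k x0 + ereal C"
    using expect_log_lower by blast
  obtain u where u: "u > 0" "\<And>x. x \<in> K \<Longrightarrow> \<phi> x \<le> u * f x"
    using norm_comparable_functionals[OF f_comp \<phi>(2)] by blast
  obtain v where v: "v > 0" "\<And>x. x \<in> K \<Longrightarrow> f x \<le> v * \<phi> x"
    using norm_comparable_functionals[OF \<phi>(2) f_comp] by blast
  have \<phi>_nonneg: "0 \<le> \<phi> x" if "x \<in> K" for x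
    using \<phi>(1) that by (auto simp: cone_functional_def)
  let ?E = "\<lambda>k x. expect_prod m p A k (\<lambda>B. elog (\<phi> (B x)))"
  have f_le: "expect_log k x \<le> ?E k x + ereal (ln v)" if "x \<in> K" for k x
  proof -
    have "elog (f (fold A w x)) \<le> elog (\<phi> (fold A w x)) + ereal (ln v)" if "set w \<subseteq> {1..m}" for w
      using fold_cone[OF that] \<open>x \<in> K\<close> v
      by (intro elog_le_add_ln) (auto simp: functional_nonneg \<phi>_nonneg)
    then have "expect_log k x \<le> expect_prod m p A k (\<lambda>B. elog (\<phi> (B x)) + ereal (ln v))"
      by (intro expect_prod_mono)
    then show ?thesis by (simp add: expect_prod_add_const)
  qed
  have \<phi>_le: "?E k x \<le> expect_log k x + ereal (ln u)" if "x \<in> K" for k x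
  proof -
    have "elog (\<phi> (fold A w x)) \<le> elog (f (fold A w x)) + ereal (ln u)" if "set w \<subseteq> {1..m}" for w
      using fold_cone[OF that] \<open>x \<in> K\<close> u
      by (intro elog_le_add_ln) (auto simp: functional_nonneg \<phi>_nonneg)
    then have "?E k x \<le> expect_prod m p A k (\<lambda>B. elog (f (B x)) + ereal (ln u))"
      by (intro expect_prod_mono)
    then show ?thesis by (simp add: expect_prod_add_const)
  qed
  have "norm_log k \<le> expect_log k x + ereal (ln u + ln (u * v) + ln v + C)"
    if x: "x \<in> K" "f x = 1" for k x
  proof -
    \<comment> \<open>This \<open>c\<close> depends on \<open>k\<close> and may be -\<infinity>. It
      is therefore added to both sides of an inequality and never subtracted.\<close>
    obtain c where c: "\<And>y. y \<in> K \<Longrightarrow> ?E k y = elog (\<phi> y) + c"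
      using expect_prod_invariant[OF \<phi>(1,3)] by blast
    have "\<phi> x0 \<le> u * (v * \<phi> x)"
      using u(2)[OF x0(1)] v(2)[OF x(1)] x0(2) x(2) u(1)
        mult_left_mono[of 1 "v * \<phi> x" u] by (auto intro: order_trans)
    then have "elog (\<phi> x0) \<le> elog (\<phi> x) + ereal (ln (u * v))"
      using u(1) v(1) x0(1) x(1) by (intro elog_le_add_ln \<phi>_nonneg) (auto simp: ac_simps)
    then have "elog (\<phi> x0) + c \<le> elog (\<phi> x) + ereal (ln (u * v)) + c"
      by (rule add_right_mono)
    then have E0: "?E k x0 \<le> ?E k x + ereal (ln (u * v))"
      by (simp only: c[OF x(1)] c[OF x0(1)] ac_simps)
    have "norm_log k \<le> expect_log k x0 + ereal C" by (rule x0)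
    also have "\<dots> \<le> ?E k x0 + ereal (ln v) + ereal C"
      by (intro add_right_mono f_le x0)
    also have "\<dots> \<le> ?E k x + ereal (ln (u * v)) + ereal (ln v) + ereal C"
      by (intro add_right_mono E0)
    also have "\<dots> \<le> expect_log k x + ereal (ln u) + ereal (ln (u * v)) + ereal (ln v) + ereal C"
      by (intro add_right_mono \<phi>_le x)
    finally show ?thesis by (simp add: add.assoc)
  qed
  then show thesis using that by blast
qed

lemma F_min_tendsto:
  assumes \<phi>: "cone_functional K \<phi>" "norm_comparable K \<phi>" "invariant_for m p A K \<phi>"
  shows "F_min m p A K f \<longlonglongrightarrow> lyapunov_exponent m p A"
    and "\<exists>C::real. \<forall>k. F_max m p A K f k \<le> F_min m p A K f k + ereal (C / real k)"
proof -
  let ?inf_log = "\<lambda>k. INF x\<in>{x\<in>K. f x = 1}. expect_log k x"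
  obtain x0 where x0: "x0 \<in> K" "f x0 = 1"
    using expect_log_lower by blast
  obtain C where C: "\<And>k x. x \<in> K \<Longrightarrow> f x = 1 \<Longrightarrow> norm_log k \<le> expect_log k x + ereal C"
    using invariant_expect_log_lower[OF \<phi>] by blast
  obtain D where D: "\<And>k. sup_log k \<le> norm_log k + ereal D"
    using sup_log_upper by blast
  have sup_le: "sup_log k \<le> ?inf_log k + ereal (C + D)" for k
  proof -
    have "norm_log k + ereal (- C) \<le> ?inf_log k"
    proof (rule INF_greatest)
      fix x assume "x \<in> {x \<in> K. f x = 1}"
      then show "norm_log k + ereal (- C) \<le> expect_log k x"
        using C[of x k] by (cases "norm_log k"; cases "expect_log k x") auto
    qed
    then show ?thesis using D[of k]
      by (cases "norm_log k"; cases "sup_log k"; cases "?inf_log k") auto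
  qed
  \<comment> \<open>The infimum lies below the supremum because \<open>x0\<close> shows the level
    set to be nonempty.\<close>
  have inf_le: "?inf_log k \<le> sup_log k + ereal 0" for k
    using x0 by (auto intro!: INF_le_SUP)
  have "(\<lambda>k. ereal (1 / real k) * sup_log k) \<longlonglongrightarrow> lyapunov_exponent m p A"
    using F_max_tendsto by (simp add: F_max_def[abs_def])
  from tendsto_average_bounded_difference[OF this sup_le inf_le]
  show "F_min m p A K f \<longlonglongrightarrow> lyapunov_exponent m p A"
    by (simp add: F_min_def[abs_def])
  \<comment> \<open>At \<open>k\<close> = 0 division by zero gives 0, so both sides vanish and the
    bound holds there as well.\<close>
  have "F_max m p A K f k \<le> F_min m p A K f k + ereal ((C + D) / real k)" for k
  proof -
    have "F_max m p A K f k \<le> ereal (1 / real k) * (?inf_log k + ereal (C + D))"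
      unfolding F_max_def by (intro ereal_mult_left_mono sup_le) auto
    then show ?thesis by (simp add: F_min_def ereal_times_add_distrib)
  qed
  then show "\<exists>C::real. \<forall>k. F_max m p A K f k \<le> F_min m p A K f k + ereal (C / real k)"
    by blast
qed

end

text \<open>Convergence is asserted beside each limit, since \<open>lim\<close> denotes some value
  even for a divergent sequence.\<close>

theorem theorem1:
  fixes m :: nat and p :: "nat \<Rightarrow> real"
    and A :: "nat \<Rightarrow> real ^ 'n \<Rightarrow> real ^ 'n"
    and K :: "(real ^ 'n) set" and f :: "real ^ 'n \<Rightarrow> real"
  assumes "\<And>j. j \<in> {1..m} \<Longrightarrow> p j > 0"
    and "(\<Sum>j=1..m. p j) = 1"
    and "\<And>j. j \<in> {1..m} \<Longrightarrow> linear (A j)"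
    and "solid_pointed_cone K"
    and "\<And>j. j \<in> {1..m} \<Longrightarrow> A j ` K \<subseteq> K"
    and "cone_functional K f" and "norm_comparable K f"
  shows "convergent (F_max m p A K f) \<and>
         F_max_lim m p A K f = lyapunov_exponent m p A \<and>
         ((\<exists>\<phi>. cone_functional K \<phi> \<and> norm_comparable K \<phi> \<and> invariant_for m p A K \<phi>) \<longrightarrow>
            convergent (F_min m p A K f) \<and>
            F_min_lim m p A K f = lyapunov_exponent m p A \<and>
            (\<exists>C::real. \<forall>k\<ge>1. F_max m p A K f k \<le> F_min m p A K f k + ereal (C / real k)))"
proof -
  interpret random_product_functional m p A K f
    by (intro random_product_functional.intro random_product_functional_axioms.intro
        random_product_cone.intro random_product_cone_axioms.intro random_product.intro assms)
  have "convergent (F_max m p A K f)" "F_max_lim m p A K f = lyapunov_exponent m p A"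
    using F_max_tendsto by (auto simp: F_max_lim_def intro: convergentI limI)
  moreover have "convergent (F_min m p A K f)" "F_min_lim m p A K f = lyapunov_exponent m p A"
    "\<exists>C::real. \<forall>k\<ge>1. F_max m p A K f k \<le> F_min m p A K f k + ereal (C / real k)"
    if "cone_functional K \<phi>" "norm_comparable K \<phi>" "invariant_for m p A K \<phi>" for \<phi>
    using F_min_tendsto[OF that]
    by (auto simp: F_min_lim_def intro: convergentI limI)
  ultimately show ?thesis by blast
qed

end
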